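(* Let $\mathbb{P}$ be a prop, let $\mathcal{C},\mathcal{D}$ be symmetric monoidal categories, let $s$ be a supply of $\mathbb{P}$ in $\mathcal{C}$ and $t$ a supply of $\mathbb{P}$ in $\mathcal{D}$, and suppose that $(F,\varphi)\colon\mathcal{C}\to\mathcal{D}$ is a strong monoidal functor preserving the supply. Then the strongators of $F$ are $t$-homomorphisms; that is, for each morphism $\mu\colon m\to n$ in $\mathbb{P}$ and all objects $c,c'\in\mathcal{C}$, $$(\varphi_{c,c'})^{\otimes n}\circ t_{Fc\otimes Fc'}(\mu)=t_{F(c\otimes c')}(\mu)\circ(\varphi_{c,c'})^{\otimes m}\quad\text{as maps }(Fc\otimes Fc')^{\otimes m}\to F(c\otimes c')^{\otimes n},$$ and, for $\varphi\colon I_{\mathcal{D}}\to F(I_{\mathcal{C}})$, $$\varphi^{\otimes n}\circ t_{I}(\mu)=t_{F(I)}(\mu)\circ\varphi^{\otimes m}\quad\text{as maps }I^{\otimes m}\to F(I)^{\otimes n}.$$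
   Context: Strong monoidal functors between symmetric monoidal categories are always understood to be symmetric; the structure isomorphisms $\varphi\colon I_{\mathcal{D}}\to F(I_{\mathcal{C}})$ and $\varphi_{c,c'}\colon F(c)\otimes F(c')\to F(c\otimes c')$ are called strongators. In a symmetric monoidal category $(\mathcal{C},I,\otimes)$, write $b^{\otimes m}$ for the left-bracketed $m$-fold product $((b\otimes b)\otimes\cdots)\otimes b$, with $b^{\otimes 0}=I$ and $b^{\otimes 1}=b$. Write $\sigma\colon c^{\otimes n}\otimes d^{\otimes n}\to(c\otimes d)^{\otimes n}$ and $\sigma\colon I\to I^{\otimes n}$ for the canonical (Mac Lane coherence) isomorphisms, the first one realizing the evident shuffle permutation. A prop is a symmetric strict monoidal category whose monoid of objects is $(\mathbb{N},0,+)$. A supply $s$ of a prop $\mathbb{P}$ in $\mathcal{C}$ consists of a strong monoidal functor $s_c\colon\mathbb{P}\to\mathcal{C}$ for each object $c\in\mathcal{C}$ such that: (i) $s_c(m)=c^{\otimes m}$ for each $m\in\mathbb{N}$; (ii) the strongator $c^{\otimes m}\otimes c^{\otimes n}\to c^{\otimes(m+n)}$ is the unique coherence (rebracketing) isomorphism for each $m,n$; (iii) for all $c,d\in\mathcal{C}$ and $\mu\colon m\to n$ in $\mathbb{P}$, $s_{c\otimes d}(\mu)\circ\sigma=\sigma\circ(s_c(\mu)\otimes s_d(\mu))$ as maps $c^{\otimes m}\otimes d^{\otimes m}\to(c\otimes d)^{\otimes n}$, and $s_I(\mu)\circ\sigma=\sigma$ as maps $I\to I^{\otimes n}$. A morphism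 $f\colon c\to d$ in $\mathcal{C}$ is an $s$-homomorphism if $f^{\otimes n}\circ s_c(\mu)=s_d(\mu)\circ f^{\otimes m}$ for every $\mu\colon m\to n$ in $\mathbb{P}$. Given supplies $s$ of $\mathbb{P}$ in $\mathcal{C}$ and $t$ of $\mathbb{P}$ in $\mathcal{D}$, a strong monoidal functor $(F,\varphi)\colon\mathcal{C}\to\mathcal{D}$ preserves the supply if for each $c\in\mathcal{C}$ and $\mu\colon m\to n$ in $\mathbb{P}$ one has $\varphi\circ t_{F(c)}(\mu)=F(s_c(\mu))\circ\varphi$ as maps $F(c)^{\otimes m}\to F(c^{\otimes n})$, where $\varphi\colon F(c)^{\otimes k}\to F(c^{\otimes k})$ denotes the iterated strongator. *)

theory Defs
  imports Main
begin

section \<open>Symmetric monoidal categories\<close>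

text \<open>
  Every arrow carries a unique domain and codomain.  \<open>TenA\<close> is the tensor product of arrows.
  All operations are total HOL functions; only their values on \<^term>\<open>Obj C\<close>, \<^term>\<open>Arr C\<close> and on
  composable pairs are meaningful.  Composition \<open>g \<cdot> f\<close> is written in applicative order.
\<close>

record ('o, 'a) smcat =
  Obj :: "'o set"
  Arr :: "'a set"
  Dom :: "'a \<Rightarrow> 'o"
  Cod :: "'a \<Rightarrow> 'o"
  Idn :: "'o \<Rightarrow> 'a"
  Cmp :: "'a \<Rightarrow> 'a \<Rightarrow> 'a" (infixr \<open>\<cdot>\<index>\<close> 55)
  Ten :: "'o \<Rightarrow> 'o \<Rightarrow> 'o" (infixl \<open>\<otimes>\<index>\<close> 70)
  TenA :: "'a \<Rightarrow> 'a \<Rightarrow> 'a" (infixl \<open>\<otimes>\<^sub>a\<index>\<close> 70)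
  Unit :: "'o"
  Assoc :: "'o \<Rightarrow> 'o \<Rightarrow> 'o \<Rightarrow> 'a"
  LUnit :: "'o \<Rightarrow> 'a"
  RUnit :: "'o \<Rightarrow> 'a"
  Braid :: "'o \<Rightarrow> 'o \<Rightarrow> 'a"

definition Hom :: "('o, 'a) smcat \<Rightarrow> 'o \<Rightarrow> 'o \<Rightarrow> 'a set" where
  "Hom C a b = {f \<in> Arr C. Dom C f = a \<and> Cod C f = b}"

definition inverse_arrows :: "('o, 'a) smcat \<Rightarrow> 'a \<Rightarrow> 'a \<Rightarrow> bool" where
  "inverse_arrows C f g \<longleftrightarrow>
     f \<in> Arr C \<and> g \<in> Hom C (Cod C f) (Dom C f) \<and>
     Cmp C g f = Idn C (Dom C f) \<and> Cmp C f g = Idn C (Cod C f)"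

definition iso :: "('o, 'a) smcat \<Rightarrow> 'a \<Rightarrow> bool" where
  "iso C f \<longleftrightarrow> (\<exists>g. inverse_arrows C f g)"

definition inv_arr :: "('o, 'a) smcat \<Rightarrow> 'a \<Rightarrow> 'a" where
  "inv_arr C f = (THE g. inverse_arrows C f g)"

locale category =
  fixes C :: "('o, 'a) smcat" (structure)
  assumes Dom_Obj: "f \<in> Arr C \<Longrightarrow> Dom C f \<in> Obj C"
    and Cod_Obj: "f \<in> Arr C \<Longrightarrow> Cod C f \<in> Obj C"
    and Idn_Hom: "a \<in> Obj C \<Longrightarrow> Idn C a \<in> Hom C a a"
    and Cmp_Hom: "\<lbrakk>f \<in> Hom C a b; g \<in> Hom C b c\<rbrakk> \<Longrightarrow> g \<cdot> f \<in> Hom C a c"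
    and Cmp_Idn_left: "f \<in> Hom C a b \<Longrightarrow> Idn C b \<cdot> f = f"
    and Cmp_Idn_right: "f \<in> Hom C a b \<Longrightarrow> f \<cdot> Idn C a = f"
    and Cmp_assoc: "\<lbrakk>f \<in> Hom C a b; g \<in> Hom C b c; h \<in> Hom C c d\<rbrakk>
      \<Longrightarrow> (h \<cdot> g) \<cdot> f = h \<cdot> (g \<cdot> f)"

locale symmetric_monoidal_category = category +
  assumes Unit_Obj: "Unit C \<in> Obj C"
    and Ten_Obj: "\<lbrakk>a \<in> Obj C; b \<in> Obj C\<rbrakk> \<Longrightarrow> a \<otimes> b \<in> Obj C"
    and TenA_Hom: "\<lbrakk>f \<in> Hom C a b; g \<in> Hom C a' b'\<rbrakk>
      \<Longrightarrow> f \<otimes>\<^sub>a g \<in> Hom C (a \<otimes> a') (b \<otimes> b')"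
    and TenA_Idn: "\<lbrakk>a \<in> Obj C; b \<in> Obj C\<rbrakk>
      \<Longrightarrow> Idn C a \<otimes>\<^sub>a Idn C b = Idn C (a \<otimes> b)"
    and TenA_Cmp: "\<lbrakk>f \<in> Hom C a b; g \<in> Hom C b c; f' \<in> Hom C a' b'; g' \<in> Hom C b' c'\<rbrakk>
      \<Longrightarrow> (g \<cdot> f) \<otimes>\<^sub>a (g' \<cdot> f') = (g \<otimes>\<^sub>a g') \<cdot> (f \<otimes>\<^sub>a f')"
    and Assoc_Hom: "\<lbrakk>a \<in> Obj C; b \<in> Obj C; c \<in> Obj C\<rbrakk>
      \<Longrightarrow> Assoc C a b c \<in> Hom C ((a \<otimes> b) \<otimes> c) (a \<otimes> (b \<otimes> c))"
    and Assoc_iso: "\<lbrakk>a \<in> Obj C; b \<in> Obj C; c \<in> Obj C\<rbrakk> \<Longrightarrow> iso C (Assoc C a b c)"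
    and Assoc_natural: "\<lbrakk>f \<in> Hom C a a'; g \<in> Hom C b b'; h \<in> Hom C c c'\<rbrakk>
      \<Longrightarrow> Assoc C a' b' c' \<cdot> ((f \<otimes>\<^sub>a g) \<otimes>\<^sub>a h) = (f \<otimes>\<^sub>a (g \<otimes>\<^sub>a h)) \<cdot> Assoc C a b c"
    and LUnit_Hom: "a \<in> Obj C \<Longrightarrow> LUnit C a \<in> Hom C (Unit C \<otimes> a) a"
    and LUnit_iso: "a \<in> Obj C \<Longrightarrow> iso C (LUnit C a)"
    and LUnit_natural: "f \<in> Hom C a b
      \<Longrightarrow> LUnit C b \<cdot> (Idn C (Unit C) \<otimes>\<^sub>a f) = f \<cdot> LUnit C a"
    and RUnit_Hom: "a \<in> Obj C \<Longrightarrow> RUnit C a \<in> Hom C (a \<otimes> Unit C) a"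
    and RUnit_iso: "a \<in> Obj C \<Longrightarrow> iso C (RUnit C a)"
    and RUnit_natural: "f \<in> Hom C a b
      \<Longrightarrow> RUnit C b \<cdot> (f \<otimes>\<^sub>a Idn C (Unit C)) = f \<cdot> RUnit C a"
    and Braid_Hom: "\<lbrakk>a \<in> Obj C; b \<in> Obj C\<rbrakk> \<Longrightarrow> Braid C a b \<in> Hom C (a \<otimes> b) (b \<otimes> a)"
    and Braid_natural: "\<lbrakk>f \<in> Hom C a a'; g \<in> Hom C b b'\<rbrakk>
      \<Longrightarrow> Braid C a' b' \<cdot> (f \<otimes>\<^sub>a g) = (g \<otimes>\<^sub>a f) \<cdot> Braid C a b"
    and pentagon: "\<lbrakk>a \<in> Obj C; b \<in> Obj C; c \<in> Obj C; d \<in> Obj C\<rbrakk>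
      \<Longrightarrow> Assoc C a b (c \<otimes> d) \<cdot> Assoc C (a \<otimes> b) c d =
        (Idn C a \<otimes>\<^sub>a Assoc C b c d) \<cdot> Assoc C a (b \<otimes> c) d \<cdot> (Assoc C a b c \<otimes>\<^sub>a Idn C d)"
    and triangle: "\<lbrakk>a \<in> Obj C; b \<in> Obj C\<rbrakk>
      \<Longrightarrow> (Idn C a \<otimes>\<^sub>a LUnit C b) \<cdot> Assoc C a (Unit C) b = RUnit C a \<otimes>\<^sub>a Idn C b"
    and hexagon: "\<lbrakk>a \<in> Obj C; b \<in> Obj C; c \<in> Obj C\<rbrakk>
      \<Longrightarrow> Assoc C b c a \<cdot> Braid C a (b \<otimes> c) \<cdot> Assoc C a b c =
        (Idn C b \<otimes>\<^sub>a Braid C a c) \<cdot> Assoc C b a c \<cdot> (Braid C a b \<otimes>\<^sub>a Idn C c)"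
    and symmetry: "\<lbrakk>a \<in> Obj C; b \<in> Obj C\<rbrakk>
      \<Longrightarrow> Braid C b a \<cdot> Braid C a b = Idn C (a \<otimes> b)"

locale symmetric_strict_monoidal_category = symmetric_monoidal_category +
  assumes Ten_assoc: "\<lbrakk>a \<in> Obj C; b \<in> Obj C; c \<in> Obj C\<rbrakk> \<Longrightarrow> (a \<otimes> b) \<otimes> c = a \<otimes> (b \<otimes> c)"
    and Ten_Unit_left: "a \<in> Obj C \<Longrightarrow> Unit C \<otimes> a = a"
    and Ten_Unit_right: "a \<in> Obj C \<Longrightarrow> a \<otimes> Unit C = a"
    and Assoc_strict: "\<lbrakk>a \<in> Obj C; b \<in> Obj C; c \<in> Obj C\<rbrakk>
      \<Longrightarrow> Assoc C a b c = Idn C ((a \<otimes> b) \<otimes> c)"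
    and LUnit_strict: "a \<in> Obj C \<Longrightarrow> LUnit C a = Idn C a"
    and RUnit_strict: "a \<in> Obj C \<Longrightarrow> RUnit C a = Idn C a"

locale prop_category = symmetric_strict_monoidal_category P
  for P :: "(nat, 'p) smcat" +
  assumes prop_Obj: "Obj P = UNIV"
    and prop_Unit: "Unit P = 0"
    and prop_Ten: "Ten P m n = m + n"


section \<open>Strong symmetric monoidal functors\<close>

text \<open>
  \<open>Strg0 : I \<rightarrow> F(I)\<close> and \<open>Strg a b : F(a) \<otimes> F(b) \<rightarrow> F(a \<otimes> b)\<close> are the strongators.
\<close>

record ('o, 'a, 'o2, 'a2) monfun =
  FObj :: "'o \<Rightarrow> 'o2"
  FArr :: "'a \<Rightarrow> 'a2"
  Strg0 :: "'a2"
  Strg :: "'o \<Rightarrow> 'o \<Rightarrow> 'a2"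

locale strong_monoidal_functor =
  C: symmetric_monoidal_category C + D: symmetric_monoidal_category D
  for C :: "('o, 'a) smcat" and D :: "('o2, 'a2) smcat" +
  fixes F :: "('o, 'a, 'o2, 'a2) monfun"
  assumes FObj_Obj: "a \<in> Obj C \<Longrightarrow> FObj F a \<in> Obj D"
    and FArr_Hom: "f \<in> Hom C a b \<Longrightarrow> FArr F f \<in> Hom D (FObj F a) (FObj F b)"
    and FArr_Idn: "a \<in> Obj C \<Longrightarrow> FArr F (Idn C a) = Idn D (FObj F a)"
    and FArr_Cmp: "\<lbrakk>f \<in> Hom C a b; g \<in> Hom C b c\<rbrakk>
      \<Longrightarrow> FArr F (g \<cdot>\<^bsub>C\<^esub> f) = FArr F g \<cdot>\<^bsub>D\<^esub> FArr F f"
    and Strg0_Hom: "Strg0 F \<in> Hom D (Unit D) (FObj F (Unit C))"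
    and Strg0_iso: "iso D (Strg0 F)"
    and Strg_Hom: "\<lbrakk>a \<in> Obj C; b \<in> Obj C\<rbrakk>
      \<Longrightarrow> Strg F a b \<in> Hom D (FObj F a \<otimes>\<^bsub>D\<^esub> FObj F b) (FObj F (a \<otimes>\<^bsub>C\<^esub> b))"
    and Strg_iso: "\<lbrakk>a \<in> Obj C; b \<in> Obj C\<rbrakk> \<Longrightarrow> iso D (Strg F a b)"
    and Strg_natural: "\<lbrakk>f \<in> Hom C a a'; g \<in> Hom C b b'\<rbrakk>
      \<Longrightarrow> Strg F a' b' \<cdot>\<^bsub>D\<^esub> (FArr F f \<otimes>\<^sub>a\<^bsub>D\<^esub> FArr F g) =
        FArr F (f \<otimes>\<^sub>a\<^bsub>C\<^esub> g) \<cdot>\<^bsub>D\<^esub> Strg F a b"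
    and Strg_Assoc: "\<lbrakk>a \<in> Obj C; b \<in> Obj C; c \<in> Obj C\<rbrakk>
      \<Longrightarrow> FArr F (Assoc C a b c) \<cdot>\<^bsub>D\<^esub> Strg F (a \<otimes>\<^bsub>C\<^esub> b) c
          \<cdot>\<^bsub>D\<^esub> (Strg F a b \<otimes>\<^sub>a\<^bsub>D\<^esub> Idn D (FObj F c)) =
        Strg F a (b \<otimes>\<^bsub>C\<^esub> c) \<cdot>\<^bsub>D\<^esub> (Idn D (FObj F a) \<otimes>\<^sub>a\<^bsub>D\<^esub> Strg F b c)
          \<cdot>\<^bsub>D\<^esub> Assoc D (FObj F a) (FObj F b) (FObj F c)"
    and Strg_LUnit: "a \<in> Obj C
      \<Longrightarrow> FArr F (LUnit C a) \<cdot>\<^bsub>D\<^esub> Strg F (Unit C) a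
          \<cdot>\<^bsub>D\<^esub> (Strg0 F \<otimes>\<^sub>a\<^bsub>D\<^esub> Idn D (FObj F a)) = LUnit D (FObj F a)"
    and Strg_RUnit: "a \<in> Obj C
      \<Longrightarrow> FArr F (RUnit C a) \<cdot>\<^bsub>D\<^esub> Strg F a (Unit C)
          \<cdot>\<^bsub>D\<^esub> (Idn D (FObj F a) \<otimes>\<^sub>a\<^bsub>D\<^esub> Strg0 F) = RUnit D (FObj F a)"
    and Strg_Braid: "\<lbrakk>a \<in> Obj C; b \<in> Obj C\<rbrakk>
      \<Longrightarrow> FArr F (Braid C a b) \<cdot>\<^bsub>D\<^esub> Strg F a b =
        Strg F b a \<cdot>\<^bsub>D\<^esub> Braid D (FObj F a) (FObj F b)"


section \<open>Tensor powers and canonical isomorphisms\<close>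

fun tpow :: "('o, 'a) smcat \<Rightarrow> 'o \<Rightarrow> nat \<Rightarrow> 'o" where
  "tpow C c 0 = Unit C"
| "tpow C c (Suc 0) = c"
| "tpow C c (Suc (Suc n)) = tpow C c (Suc n) \<otimes>\<^bsub>C\<^esub> c"

fun tpowA :: "('o, 'a) smcat \<Rightarrow> 'a \<Rightarrow> nat \<Rightarrow> 'a" where
  "tpowA C f 0 = Idn C (Unit C)"
| "tpowA C f (Suc 0) = f"
| "tpowA C f (Suc (Suc n)) = tpowA C f (Suc n) \<otimes>\<^sub>a\<^bsub>C\<^esub> f"

text \<open>
  Mac Lane's coherence theorem says that a composite of structure isomorphisms is determined by
  its (formal) source and target and its underlying permutation.  The canonical isomorphisms are
  therefore given by one such composite each, by recursion along the left bracketing.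
\<close>

text \<open>Rebracketing \<open>c\<^sup>m \<otimes> c\<^sup>n \<rightarrow> c\<^sup>m\<^sup>+\<^sup>n\<close>, built without the braiding.\<close>

fun rebracket :: "('o, 'a) smcat \<Rightarrow> 'o \<Rightarrow> nat \<Rightarrow> nat \<Rightarrow> 'a" where
  "rebracket C c 0 n = LUnit C (tpow C c n)"
| "rebracket C c (Suc m) 0 = RUnit C (tpow C c (Suc m))"
| "rebracket C c (Suc m) (Suc 0) = Idn C (tpow C c (Suc (Suc m)))"
| "rebracket C c (Suc m) (Suc (Suc n)) =
     (rebracket C c (Suc m) (Suc n) \<otimes>\<^sub>a\<^bsub>C\<^esub> Idn C c)
     \<cdot>\<^bsub>C\<^esub> inv_arr C (Assoc C (tpow C c (Suc m)) (tpow C c (Suc n)) c)"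

text \<open>
  The middle-four interchange \<open>(a \<otimes> b) \<otimes> (c \<otimes> d) \<rightarrow> (a \<otimes> c) \<otimes> (b \<otimes> d)\<close>, which braids \<open>b\<close> past \<open>c\<close>.
\<close>

definition interchange :: "('o, 'a) smcat \<Rightarrow> 'o \<Rightarrow> 'o \<Rightarrow> 'o \<Rightarrow> 'o \<Rightarrow> 'a" where
  "interchange C a b c d =
     inv_arr C (Assoc C a c (b \<otimes>\<^bsub>C\<^esub> d))
     \<cdot>\<^bsub>C\<^esub> (Idn C a \<otimes>\<^sub>a\<^bsub>C\<^esub> Assoc C c b d)
     \<cdot>\<^bsub>C\<^esub> (Idn C a \<otimes>\<^sub>a\<^bsub>C\<^esub> (Braid C b c \<otimes>\<^sub>a\<^bsub>C\<^esub> Idn C d))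
     \<cdot>\<^bsub>C\<^esub> (Idn C a \<otimes>\<^sub>a\<^bsub>C\<^esub> inv_arr C (Assoc C b c d))
     \<cdot>\<^bsub>C\<^esub> Assoc C a b (c \<otimes>\<^bsub>C\<^esub> d)"

text \<open>
  The shuffle \<open>\<sigma> : c\<^sup>n \<otimes> d\<^sup>n \<rightarrow> (c \<otimes> d)\<^sup>n\<close>, realizing the permutation
  \<open>c\<^sub>1 \<dots> c\<^sub>n d\<^sub>1 \<dots> d\<^sub>n \<mapsto> c\<^sub>1 d\<^sub>1 \<dots> c\<^sub>n d\<^sub>n\<close>: the last factors of \<open>c\<^sup>n\<^sup>+\<^sup>1\<close> and \<open>d\<^sup>n\<^sup>+\<^sup>1\<close> are brought
  together at the far right, and the remaining factors are shuffled recursively.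
\<close>

fun shuffle :: "('o, 'a) smcat \<Rightarrow> 'o \<Rightarrow> 'o \<Rightarrow> nat \<Rightarrow> 'a" where
  "shuffle C c d 0 = LUnit C (Unit C)"
| "shuffle C c d (Suc 0) = Idn C (c \<otimes>\<^bsub>C\<^esub> d)"
| "shuffle C c d (Suc (Suc n)) =
     (shuffle C c d (Suc n) \<otimes>\<^sub>a\<^bsub>C\<^esub> Idn C (c \<otimes>\<^bsub>C\<^esub> d))
     \<cdot>\<^bsub>C\<^esub> interchange C (tpow C c (Suc n)) c (tpow C d (Suc n)) d"

text \<open>The canonical isomorphism \<open>\<sigma> : I \<rightarrow> I\<^sup>n\<close>.\<close>

fun shuffle_unit :: "('o, 'a) smcat \<Rightarrow> nat \<Rightarrow> 'a" where
  "shuffle_unit C 0 = Idn C (Unit C)"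
| "shuffle_unit C (Suc 0) = Idn C (Unit C)"
| "shuffle_unit C (Suc (Suc n)) =
     (shuffle_unit C (Suc n) \<otimes>\<^sub>a\<^bsub>C\<^esub> Idn C (Unit C)) \<cdot>\<^bsub>C\<^esub> inv_arr C (LUnit C (Unit C))"

text \<open>The iterated strongator \<open>\<phi> : F(c)\<^sup>n \<rightarrow> F(c\<^sup>n)\<close>.\<close>

fun iter_strg ::
  "('o, 'a) smcat \<Rightarrow> ('o2, 'a2) smcat \<Rightarrow> ('o, 'a, 'o2, 'a2) monfun \<Rightarrow> 'o \<Rightarrow> nat \<Rightarrow> 'a2" where
  "iter_strg C D F c 0 = Strg0 F"
| "iter_strg C D F c (Suc 0) = Idn D (FObj F c)"
| "iter_strg C D F c (Suc (Suc n)) =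
     Strg F (tpow C c (Suc n)) c
     \<cdot>\<^bsub>D\<^esub> (iter_strg C D F c (Suc n) \<otimes>\<^sub>a\<^bsub>D\<^esub> Idn D (FObj F c))"


section \<open>Supplies\<close>

text \<open>
  The unit strongator \<open>I \<rightarrow> s\<^sub>c(0) = I\<close> is not constrained separately: unitality of the strong
  monoidal functor \<open>s\<^sub>c\<close> together with \<open>supply_Strg\<close> forces it to be the identity.
\<close>

locale prop_supply =
  P: prop_category P + C: symmetric_monoidal_category C
  for P :: "(nat, 'p) smcat" and C :: "('o, 'a) smcat" +
  fixes s :: "'o \<Rightarrow> (nat, 'p, 'o, 'a) monfun"
  assumes supply_functor: "c \<in> Obj C \<Longrightarrow> strong_monoidal_functor P C (s c)"
    and supply_FObj: "c \<in> Obj C \<Longrightarrow> FObj (s c) m = tpow C c m"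
    and supply_Strg: "c \<in> Obj C \<Longrightarrow> Strg (s c) m n = rebracket C c m n"
    and supply_Ten: "\<lbrakk>c \<in> Obj C; d \<in> Obj C; \<mu> \<in> Hom P m n\<rbrakk>
      \<Longrightarrow> FArr (s (c \<otimes>\<^bsub>C\<^esub> d)) \<mu> \<cdot>\<^bsub>C\<^esub> shuffle C c d m =
        shuffle C c d n \<cdot>\<^bsub>C\<^esub> (FArr (s c) \<mu> \<otimes>\<^sub>a\<^bsub>C\<^esub> FArr (s d) \<mu>)"
    and supply_Unit: "\<mu> \<in> Hom P m n
      \<Longrightarrow> FArr (s (Unit C)) \<mu> \<cdot>\<^bsub>C\<^esub> shuffle_unit C m = shuffle_unit C n"

definition supply_hom ::
  "(nat, 'p) smcat \<Rightarrow> ('o, 'a) smcat \<Rightarrow> ('o \<Rightarrow> (nat, 'p, 'o, 'a) monfun) \<Rightarrow> 'a \<Rightarrow> bool" where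
  "supply_hom P C s f \<longleftrightarrow> f \<in> Arr C \<and>
     (\<forall>m n. \<forall>\<mu>\<in>Hom P m n.
        tpowA C f n \<cdot>\<^bsub>C\<^esub> FArr (s (Dom C f)) \<mu> = FArr (s (Cod C f)) \<mu> \<cdot>\<^bsub>C\<^esub> tpowA C f m)"

definition preserves_supply ::
  "(nat, 'p) smcat \<Rightarrow> ('o, 'a) smcat \<Rightarrow> ('o2, 'a2) smcat
   \<Rightarrow> ('o \<Rightarrow> (nat, 'p, 'o, 'a) monfun) \<Rightarrow> ('o2 \<Rightarrow> (nat, 'p, 'o2, 'a2) monfun)
   \<Rightarrow> ('o, 'a, 'o2, 'a2) monfun \<Rightarrow> bool" where
  "preserves_supply P C D s t F \<longleftrightarrow>
     (\<forall>c\<in>Obj C. \<forall>m n. \<forall>\<mu>\<in>Hom P m n.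
        iter_strg C D F c n \<cdot>\<^bsub>D\<^esub> FArr (t (FObj F c)) \<mu> =
        FArr F (FArr (s c) \<mu>) \<cdot>\<^bsub>D\<^esub> iter_strg C D F c m)"

end

theory Submission
  imports Defs
begin

text \<open>
  Write \<open>X = F c\<close>, \<open>Y = F d\<close> and \<open>\<phi>\<^sub>n : F(c)\<^sup>n \<rightarrow> F(c\<^sup>n)\<close> for the iterated strongator.  Since \<open>F\<close> is
  symmetric monoidal, \<open>\<phi>\<^sub>n \<circ> \<phi>\<^sup>n \<circ> \<sigma> = F(\<sigma>) \<circ> \<phi> \<circ> (\<phi>\<^sub>n \<otimes> \<phi>\<^sub>n)\<close> as maps
  \<open>X\<^sup>n \<otimes> Y\<^sup>n \<rightarrow> F((c \<otimes> d)\<^sup>n)\<close>.  Combined with the compatibility of both supplies with \<open>\<sigma>\<close> and the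
  preservation of the supply by \<open>F\<close>, this shows that the two sides of the claim agree after composing
  with the isomorphisms \<open>\<sigma>\<close> and \<open>\<phi>\<^sub>n\<close>.  All squares involved are morphisms of the comma category
  \<open>D \<down> F\<close>; it inherits the symmetric monoidal structure, so that the shuffles of \<open>C\<close> and \<open>D\<close>
  assemble to morphisms there by following their construction.
\<close>


section \<open>Isomorphisms\<close>

context category
begin

lemma Hom_iff: "f \<in> Hom C a b \<longleftrightarrow> f \<in> Arr C \<and> Dom C f = a \<and> Cod C f = b"
  by (simp add: Hom_def)

lemma Arr_Hom: "f \<in> Arr C \<Longrightarrow> f \<in> Hom C (Dom C f) (Cod C f)"
  by (simp add: Hom_iff)

lemma Hom_Obj: "f \<in> Hom C a b \<Longrightarrow> a \<in> Obj C \<and> b \<in> Obj C"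
  using Dom_Obj Cod_Obj by (auto simp: Hom_iff)

lemma Idn_arr [simp]:
  assumes "a \<in> Obj C"
  shows "Idn C a \<in> Arr C" "Dom C (Idn C a) = a" "Cod C (Idn C a) = a"
  using Idn_Hom[OF assms] by (simp_all add: Hom_iff)

lemma Cmp_arr [simp]:
  assumes "f \<in> Arr C" "g \<in> Arr C" "Dom C g = Cod C f"
  shows "g \<cdot> f \<in> Arr C" "Dom C (g \<cdot> f) = Dom C f" "Cod C (g \<cdot> f) = Cod C g"
  using Cmp_Hom[of f "Dom C f" "Cod C f" g "Cod C g"] assms by (simp_all add: Hom_iff)

lemma Cmp_Idn [simp]:
  assumes "f \<in> Arr C"
  shows "Cod C f = b \<Longrightarrow> Idn C b \<cdot> f = f" "Dom C f = a \<Longrightarrow> f \<cdot> Idn C a = f"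
  using Cmp_Idn_left Cmp_Idn_right Arr_Hom[OF assms] by auto

lemma Cmp_assoc_arr:
  assumes "f \<in> Arr C" "g \<in> Arr C" "h \<in> Arr C" "Dom C g = Cod C f" "Dom C h = Cod C g"
  shows "(h \<cdot> g) \<cdot> f = h \<cdot> g \<cdot> f"
  using Cmp_assoc[of f "Dom C f" "Cod C f" g "Cod C g" h "Cod C h"] assms by (simp add: Hom_iff)

text \<open>Composites are kept nested to the right, where \<open>h \<cdot> g\<close> is no subterm;
  this form rewrites such a pair in front of a tail \<open>f\<close>.\<close>

lemma Cmp_assoc_eq:
  assumes "h \<cdot> g = k" "f \<in> Arr C" "g \<in> Arr C" "h \<in> Arr C" "Dom C g = Cod C f" "Dom C h = Cod C g"
  shows "h \<cdot> g \<cdot> f = k \<cdot> f"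
  using Cmp_assoc_arr[of f g h] assms by simp

text \<open>Both candidates are compared through \<open>h \<cdot> f \<cdot> g\<close>. Uniqueness is
  what gives the definite description in \<open>inv_arr\<close> its meaning.\<close>

lemma inverse_arrows_unique:
  assumes "inverse_arrows C f g" "inverse_arrows C f h"
  shows "g = h"
proof -
  have "g = (h \<cdot> f) \<cdot> g"
    using assms by (simp add: inverse_arrows_def Hom_iff)
  also have "\<dots> = h \<cdot> f \<cdot> g"
    using assms by (intro Cmp_assoc_arr) (auto simp: inverse_arrows_def Hom_iff)
  also have "\<dots> = h"
    using assms by (simp add: inverse_arrows_def Hom_iff)
  finally show ?thesis .
qed

lemma inverse_arrows_inv: "iso C f \<Longrightarrow> inverse_arrows C f (inv_arr C f)"
  unfolding inv_arr_def iso_def by (metis inverse_arrows_unique theI)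

lemma iso_Arr: "iso C f \<Longrightarrow> f \<in> Arr C"
  by (auto simp: iso_def inverse_arrows_def)

lemma inv_arr [simp]:
  assumes "iso C f"
  shows "inv_arr C f \<in> Arr C" "Dom C (inv_arr C f) = Cod C f" "Cod C (inv_arr C f) = Dom C f"
    "inv_arr C f \<cdot> f = Idn C (Dom C f)" "f \<cdot> inv_arr C f = Idn C (Cod C f)"
  using inverse_arrows_inv[OF assms] by (auto simp: inverse_arrows_def Hom_iff)

lemma inv_arr_Hom: "iso C f \<Longrightarrow> f \<in> Hom C a b \<Longrightarrow> inv_arr C f \<in> Hom C b a"
  by (simp add: Hom_iff)

lemma iso_inv: "iso C f \<Longrightarrow> iso C (inv_arr C f)"
  using inverse_arrows_inv[of f] iso_Arr[of f]
  unfolding iso_def[of _ "inv_arr C f"]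
  by (intro exI[of _ f]) (auto simp: inverse_arrows_def Hom_iff)

lemma iso_Idn: "a \<in> Obj C \<Longrightarrow> iso C (Idn C a)"
  unfolding iso_def by (intro exI[of _ "Idn C a"]) (simp add: inverse_arrows_def Hom_iff)

lemma iso_Cmp:
  assumes "iso C f" "iso C g" "Dom C g = Cod C f"
  shows "iso C (g \<cdot> f)"
proof -
  have *: "f \<in> Arr C" "g \<in> Arr C"
    using assms iso_Arr by auto
  let ?f = "inv_arr C f" and ?g = "inv_arr C g"
  have "g \<cdot> f \<cdot> ?f \<cdot> ?g = Idn C (Cod C g)"
    using assms * by (simp add: Cmp_assoc_eq[of f ?f])
  moreover have "?f \<cdot> ?g \<cdot> g \<cdot> f = Idn C (Dom C f)"
    using assms * by (simp add: Cmp_assoc_eq[of ?g g])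
  ultimately have "inverse_arrows C (g \<cdot> f) (?f \<cdot> ?g)"
    using assms * by (simp add: inverse_arrows_def Hom_iff Cmp_assoc_arr)
  then show ?thesis
    by (auto simp: iso_def)
qed

lemma iso_cancel_left:
  assumes "iso C f" "f \<cdot> g = f \<cdot> h" "g \<in> Hom C a (Dom C f)" "h \<in> Hom C a (Dom C f)"
  shows "g = h"
proof -
  have "(inv_arr C f \<cdot> f) \<cdot> g = (inv_arr C f \<cdot> f) \<cdot> h"
    \<comment> \<open>With \<open>inv_arr(4)\<close> active, the simplifier would collapse the
      inverse pair before associativity could expose \<open>f \<cdot> g\<close>, to which the
      hypothesis applies.\<close>
    using assms iso_Arr[of f] by (simp add: Cmp_assoc_arr Hom_iff del: inv_arr(4))
  then show ?thesis
    using assms by (simp add: Hom_iff)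
qed

lemma iso_cancel_right:
  assumes "iso C f" "g \<cdot> f = h \<cdot> f" "g \<in> Hom C (Cod C f) b" "h \<in> Hom C (Cod C f) b"
  shows "g = h"
proof -
  have "g \<cdot> f \<cdot> inv_arr C f = h \<cdot> f \<cdot> inv_arr C f"
    using assms iso_Arr[of f] by (simp add: Cmp_assoc_arr[symmetric] Hom_iff del: inv_arr(5))
  then show ?thesis
    using assms by (simp add: Hom_iff)
qed

end


section \<open>Canonical isomorphisms\<close>

context symmetric_monoidal_category
begin

declare Unit_Obj [simp] Ten_Obj [simp]

lemma TenA_arr [simp]:
  assumes "f \<in> Arr C" "g \<in> Arr C"
  shows "f \<otimes>\<^sub>a g \<in> Arr C" "Dom C (f \<otimes>\<^sub>a g) = Dom C f \<otimes> Dom C g"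
    "Cod C (f \<otimes>\<^sub>a g) = Cod C f \<otimes> Cod C g"
  using TenA_Hom[OF Arr_Hom Arr_Hom, OF assms] by (simp_all add: Hom_iff)

lemma TenA_Cmp_arr:
  assumes "f \<in> Arr C" "g \<in> Arr C" "f' \<in> Arr C" "g' \<in> Arr C" "Dom C g = Cod C f" "Dom C g' = Cod C f'"
  shows "(g \<otimes>\<^sub>a g') \<cdot> (f \<otimes>\<^sub>a f') = (g \<cdot> f) \<otimes>\<^sub>a (g' \<cdot> f')"
  using assms by (intro TenA_Cmp[symmetric]) (auto simp: Hom_iff)

lemma LUnit_arr [simp]:
  assumes "a \<in> Obj C"
  shows "LUnit C a \<in> Arr C" "Dom C (LUnit C a) = Unit C \<otimes> a" "Cod C (LUnit C a) = a"
  using LUnit_Hom[OF assms] by (auto simp: Hom_iff)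

lemma Assoc_Braid_arr [simp]:
  assumes "a \<in> Obj C" "b \<in> Obj C"
  shows "c \<in> Obj C \<Longrightarrow> Assoc C a b c \<in> Arr C"
    "c \<in> Obj C \<Longrightarrow> Dom C (Assoc C a b c) = (a \<otimes> b) \<otimes> c"
    "c \<in> Obj C \<Longrightarrow> Cod C (Assoc C a b c) = a \<otimes> (b \<otimes> c)"
    "Braid C a b \<in> Arr C" "Dom C (Braid C a b) = a \<otimes> b" "Cod C (Braid C a b) = b \<otimes> a"
  using Assoc_Hom[OF assms] Braid_Hom[OF assms] by (auto simp: Hom_iff)

text \<open>By symmetry the opposite braiding is a two-sided inverse.\<close>

lemma iso_Braid: "a \<in> Obj C \<Longrightarrow> b \<in> Obj C \<Longrightarrow> iso C (Braid C a b)"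
  unfolding iso_def
  by (intro exI[of _ "Braid C b a"]) (simp add: inverse_arrows_def Hom_iff symmetry)

lemma iso_TenA:
  assumes "iso C f" "iso C g"
  shows "iso C (f \<otimes>\<^sub>a g)"
proof -
  have "f \<in> Arr C" "g \<in> Arr C"
    using assms iso_Arr by auto
  then have "inverse_arrows C (f \<otimes>\<^sub>a g) (inv_arr C f \<otimes>\<^sub>a inv_arr C g)"
    using assms by (simp add: inverse_arrows_def Hom_iff TenA_Cmp_arr TenA_Idn Dom_Obj Cod_Obj)
  then show ?thesis
    by (auto simp: iso_def)
qed

section \<open>Tensor powers, interchange and shuffles: typing and invertibility\<close>

lemma tpow_Obj [simp]: "c \<in> Obj C \<Longrightarrow> tpow C c n \<in> Obj C"
  \<comment> \<open>The cases 0, 1 and \<open>n + 2\<close> mirror the recursion of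
    \<open>tpow\<close>, whose first power is \<open>c\<close> itself rather than a product with the
    unit.\<close>
  by (induction n rule: induct_nat_012) auto

lemma tpowA_Hom: "f \<in> Hom C a b \<Longrightarrow> tpowA C f n \<in> Hom C (tpow C a n) (tpow C b n)"
  by (induction n rule: induct_nat_012) (auto intro: Idn_Hom TenA_Hom)

lemma interchange_Hom:
  assumes "a \<in> Obj C" "b \<in> Obj C" "c \<in> Obj C" "d \<in> Obj C"
  shows "interchange C a b c d \<in> Hom C ((a \<otimes> b) \<otimes> (c \<otimes> d)) ((a \<otimes> c) \<otimes> (b \<otimes> d))"
  using assms by (simp add: interchange_def Hom_iff Assoc_iso)

lemma iso_interchange:
  assumes "a \<in> Obj C" "b \<in> Obj C" "c \<in> Obj C" "d \<in> Obj C"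
  shows "iso C (interchange C a b c d)"
  unfolding interchange_def
  using assms by (intro iso_Cmp iso_TenA iso_inv iso_Idn iso_Braid) (simp_all add: Assoc_iso)

lemma shuffle_Hom:
  assumes "c \<in> Obj C" "d \<in> Obj C"
  shows "shuffle C c d n \<in> Hom C (tpow C c n \<otimes> tpow C d n) (tpow C (c \<otimes> d) n)"
proof (induction n rule: induct_nat_012)
  case (ge2 n)
  then show ?case
    using assms interchange_Hom[of "tpow C c (Suc n)" c "tpow C d (Suc n)" d] by (simp add: Hom_iff)
qed (use assms in \<open>simp_all add: Hom_iff\<close>)

text \<open>Lets the shuffle be cancelled on the right at the end of the main argument.\<close>

lemma iso_shuffle:
  assumes "c \<in> Obj C" "d \<in> Obj C"
  shows "iso C (shuffle C c d n)"
proof (induction n rule: induct_nat_012)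
  case (ge2 n)
  then show ?case
    using assms interchange_Hom[of "tpow C c (Suc n)" c "tpow C d (Suc n)" d]
      shuffle_Hom[OF assms, of "Suc n"]
    by (auto simp: Hom_iff intro!: iso_Cmp iso_TenA iso_Idn iso_interchange)
qed (use assms in \<open>simp_all add: iso_Idn LUnit_iso\<close>)

lemma shuffle_unit_Hom: "shuffle_unit C n \<in> Hom C (Unit C) (tpow C (Unit C) n)"
  by (induction n rule: induct_nat_012) (simp_all add: Hom_iff LUnit_iso)

lemma iso_shuffle_unit: "iso C (shuffle_unit C n)"
proof (induction n rule: induct_nat_012)
  case (ge2 n)
  then show ?case
    using shuffle_unit_Hom[of "Suc n"]
    by (auto simp: Hom_iff LUnit_iso intro!: iso_Cmp iso_TenA iso_Idn iso_inv)
qed (simp_all add: iso_Idn)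

end


section \<open>Squares over a monoidal functor\<close>

text \<open>
  \<open>intertwines f g p q\<close> says that \<open>(g, f)\<close> is a morphism \<open>(X, p, a) \<rightarrow> (Y, q, b)\<close> in the comma
  category \<open>D \<down> F\<close>; \<open>ten_strg\<close> is the tensor product of objects of that category.
\<close>

context strong_monoidal_functor
begin

definition intertwines :: "'a \<Rightarrow> 'a2 \<Rightarrow> 'a2 \<Rightarrow> 'a2 \<Rightarrow> bool" where
  "intertwines f g p q \<longleftrightarrow> f \<in> Arr C \<and> g \<in> Arr D \<and>
     p \<in> Hom D (Dom D g) (FObj F (Dom C f)) \<and> q \<in> Hom D (Cod D g) (FObj F (Cod C f)) \<and>
     FArr F f \<cdot>\<^bsub>D\<^esub> p = q \<cdot>\<^bsub>D\<^esub> g"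

definition ten_strg :: "'o \<Rightarrow> 'o \<Rightarrow> 'a2 \<Rightarrow> 'a2 \<Rightarrow> 'a2" where
  "ten_strg a b p q = Strg F a b \<cdot>\<^bsub>D\<^esub> (p \<otimes>\<^sub>a\<^bsub>D\<^esub> q)"

declare FObj_Obj [simp]

lemma FArr_arr [simp]:
  assumes "f \<in> Arr C"
  shows "FArr F f \<in> Arr D" "Dom D (FArr F f) = FObj F (Dom C f)"
    "Cod D (FArr F f) = FObj F (Cod C f)"
  using FArr_Hom[OF C.Arr_Hom, OF assms] by (simp_all add: D.Hom_iff)

lemma FArr_Cmp_arr:
  assumes "f \<in> Arr C" "g \<in> Arr C" "Dom C g = Cod C f"
  shows "FArr F (g \<cdot>\<^bsub>C\<^esub> f) = FArr F g \<cdot>\<^bsub>D\<^esub> FArr F f"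
  using assms by (intro FArr_Cmp) (auto simp: C.Hom_iff)

lemma Strg_arr [simp]:
  assumes "a \<in> Obj C" "b \<in> Obj C"
  shows "Strg F a b \<in> Arr D" "Dom D (Strg F a b) = FObj F a \<otimes>\<^bsub>D\<^esub> FObj F b"
    "Cod D (Strg F a b) = FObj F (a \<otimes>\<^bsub>C\<^esub> b)"
  using Strg_Hom[OF assms] by (simp_all add: D.Hom_iff)

lemma Strg0_arr [simp]:
  "Strg0 F \<in> Arr D" "Dom D (Strg0 F) = Unit D" "Cod D (Strg0 F) = FObj F (Unit C)"
  using Strg0_Hom by (simp_all add: D.Hom_iff)

lemma ten_strg_Hom:
  assumes "p \<in> Hom D x (FObj F a)" "q \<in> Hom D y (FObj F b)" "a \<in> Obj C" "b \<in> Obj C"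
  shows "ten_strg a b p q \<in> Hom D (x \<otimes>\<^bsub>D\<^esub> y) (FObj F (a \<otimes>\<^bsub>C\<^esub> b))"
  using assms by (simp add: ten_strg_def D.Hom_iff)

text \<open>Exhibits the strongator as the tensor product of the identity objects at
  \<open>a\<close> and \<open>b\<close> of the comma category.\<close>

lemma ten_strg_Idn: "a \<in> Obj C \<Longrightarrow> b \<in> Obj C \<Longrightarrow>
    ten_strg a b (Idn D (FObj F a)) (Idn D (FObj F b)) = Strg F a b"
  by (simp add: ten_strg_def D.TenA_Idn)

section \<open>Closure of squares under identities, composition, tensor and inverses\<close>

lemma intertwines_Idn:
  assumes "p \<in> Hom D x (FObj F a)" "a \<in> Obj C"
  shows "intertwines (Idn C a) (Idn D x) p p"
  using assms D.Hom_Obj[OF assms(1)] by (simp add: intertwines_def D.Hom_iff FArr_Idn)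

text \<open>Two squares are pasted along \<open>q\<close>. Composability in \<open>C\<close> is a
  separate hypothesis: the shared \<open>q\<close> only equates the images of the two objects under
  \<open>FObj F\<close>, which may fail to be injective.\<close>

lemma intertwines_Cmp:
  assumes "intertwines f' g' q r" "intertwines f g p q" "Dom C f' = Cod C f"
  shows "intertwines (f' \<cdot>\<^bsub>C\<^esub> f) (g' \<cdot>\<^bsub>D\<^esub> g) p r"
proof -
  have arr: "f \<in> Arr C" "f' \<in> Arr C" "g \<in> Arr D" "g' \<in> Arr D" "p \<in> Arr D" "q \<in> Arr D" "r \<in> Arr D"
    "Cod D p = FObj F (Dom C f)" "Dom D p = Dom D g" "Cod D q = FObj F (Cod C f)" "Dom D q = Cod D g"
    "Cod D r = FObj F (Cod C f')" "Dom D r = Cod D g'" "Dom D g' = Cod D g"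
    using assms by (auto simp: intertwines_def D.Hom_iff)
  have "FArr F (f' \<cdot>\<^bsub>C\<^esub> f) \<cdot>\<^bsub>D\<^esub> p = FArr F f' \<cdot>\<^bsub>D\<^esub> FArr F f \<cdot>\<^bsub>D\<^esub> p"
    using arr assms(3) by (simp add: FArr_Cmp_arr D.Cmp_assoc_arr)
  also have "\<dots> = FArr F f' \<cdot>\<^bsub>D\<^esub> q \<cdot>\<^bsub>D\<^esub> g"
    using assms by (simp add: intertwines_def)
  also have "\<dots> = (r \<cdot>\<^bsub>D\<^esub> g') \<cdot>\<^bsub>D\<^esub> g"
    using assms arr by (intro D.Cmp_assoc_eq) (auto simp: intertwines_def)
  finally show ?thesis
    using arr assms(3) by (simp add: intertwines_def D.Hom_iff D.Cmp_assoc_arr)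
qed

text \<open>Naturality of the strongator moves \<open>F(f \<otimes> f')\<close> past it;
  functoriality of the tensor product then reduces to the two given squares. The objects are named
  because \<open>p\<close> determines only the image of \<open>a\<close> under
  \<open>FObj F\<close>.\<close>

lemma intertwines_TenA:
  assumes "intertwines f g p q" "intertwines f' g' p' q'"
    and "f \<in> Hom C a b" "f' \<in> Hom C a' b'"
  shows "intertwines (f \<otimes>\<^sub>a\<^bsub>C\<^esub> f') (g \<otimes>\<^sub>a\<^bsub>D\<^esub> g') (ten_strg a a' p p') (ten_strg b b' q q')"
proof -
  note obj = C.Hom_Obj[OF assms(3)] C.Hom_Obj[OF assms(4)]
  have arr: "f \<in> Arr C" "f' \<in> Arr C" "Dom C f = a" "Cod C f = b" "Dom C f' = a'" "Cod C f' = b'"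
    "g \<in> Arr D" "g' \<in> Arr D" "p \<in> Arr D" "q \<in> Arr D" "p' \<in> Arr D" "q' \<in> Arr D"
    "Dom D p = Dom D g" "Dom D p' = Dom D g'" "Dom D q = Cod D g" "Dom D q' = Cod D g'"
    "Cod D p = FObj F a" "Cod D p' = FObj F a'" "Cod D q = FObj F b" "Cod D q' = FObj F b'"
    using assms by (auto simp: intertwines_def C.Hom_iff D.Hom_iff)
  have "FArr F (f \<otimes>\<^sub>a\<^bsub>C\<^esub> f') \<cdot>\<^bsub>D\<^esub> ten_strg a a' p p' =
      (Strg F b b' \<cdot>\<^bsub>D\<^esub> (FArr F f \<otimes>\<^sub>a\<^bsub>D\<^esub> FArr F f')) \<cdot>\<^bsub>D\<^esub> (p \<otimes>\<^sub>a\<^bsub>D\<^esub> p')"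
    unfolding ten_strg_def using arr obj Strg_natural[OF assms(3,4)]
    by (intro D.Cmp_assoc_eq) auto
  also have "\<dots> = Strg F b b' \<cdot>\<^bsub>D\<^esub> ((q \<cdot>\<^bsub>D\<^esub> g) \<otimes>\<^sub>a\<^bsub>D\<^esub> (q' \<cdot>\<^bsub>D\<^esub> g'))"
    using arr obj assms(1,2) by (simp add: D.Cmp_assoc_arr D.TenA_Cmp_arr intertwines_def)
  also have "\<dots> = ten_strg b b' q q' \<cdot>\<^bsub>D\<^esub> (g \<otimes>\<^sub>a\<^bsub>D\<^esub> g')"
    using arr obj by (simp add: ten_strg_def D.Cmp_assoc_arr D.TenA_Cmp_arr)
  finally show ?thesis
    using arr obj by (simp add: intertwines_def D.Hom_iff ten_strg_def)
qed

lemma intertwines_inv: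
  assumes "intertwines f g p q" "iso C f" "iso D g"
  shows "intertwines (inv_arr C f) (inv_arr D g) q p"
proof -
  have arr: "f \<in> Arr C" "g \<in> Arr D" "p \<in> Arr D" "q \<in> Arr D"
    "Dom D p = Dom D g" "Cod D p = FObj F (Dom C f)" "Dom D q = Cod D g" "Cod D q = FObj F (Cod C f)"
    using assms(1) by (auto simp: intertwines_def D.Hom_iff)
  \<comment> \<open>Inserting the identity as the image of an inverse pair brings
    \<open>FArr F f\<close> next to \<open>p\<close>, where the given square applies.\<close>
  have "p \<cdot>\<^bsub>D\<^esub> inv_arr D g = (FArr F (inv_arr C f) \<cdot>\<^bsub>D\<^esub> FArr F f) \<cdot>\<^bsub>D\<^esub> p \<cdot>\<^bsub>D\<^esub> inv_arr D g"
    using arr assms(2,3) by (simp flip: FArr_Cmp_arr add: FArr_Idn C.Dom_Obj)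
  also have "\<dots> = FArr F (inv_arr C f) \<cdot>\<^bsub>D\<^esub> (FArr F f \<cdot>\<^bsub>D\<^esub> p) \<cdot>\<^bsub>D\<^esub> inv_arr D g"
    using arr assms(2,3) by (simp add: D.Cmp_assoc_arr)
  also have "\<dots> = FArr F (inv_arr C f) \<cdot>\<^bsub>D\<^esub> (q \<cdot>\<^bsub>D\<^esub> g) \<cdot>\<^bsub>D\<^esub> inv_arr D g"
    using assms(1) by (simp add: intertwines_def)
  also have "\<dots> = FArr F (inv_arr C f) \<cdot>\<^bsub>D\<^esub> q"
    using arr assms(2,3) by (simp add: D.Cmp_assoc_arr)
  finally show ?thesis
    using arr assms(2,3) by (simp add: intertwines_def D.Hom_iff)
qed

section \<open>Structure isomorphisms as squares\<close>

lemma intertwines_Braid: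
  assumes "p \<in> Hom D x (FObj F a)" "q \<in> Hom D y (FObj F b)" "a \<in> Obj C" "b \<in> Obj C"
  shows "intertwines (Braid C a b) (Braid D x y) (ten_strg a b p q) (ten_strg b a q p)"
proof -
  have obj: "x \<in> Obj D" "y \<in> Obj D"
    using D.Hom_Obj assms by auto
  have arr: "p \<in> Arr D" "q \<in> Arr D" "Dom D p = x" "Dom D q = y"
    "Cod D p = FObj F a" "Cod D q = FObj F b"
    using assms by (auto simp: D.Hom_iff)
  \<comment> \<open>This is where the symmetry of \<open>F\<close> enters; naturality of the
    braiding in \<open>D\<close> then moves it past \<open>p\<close> and \<open>q\<close>.\<close>
  have "FArr F (Braid C a b) \<cdot>\<^bsub>D\<^esub> ten_strg a b p q =
      (Strg F b a \<cdot>\<^bsub>D\<^esub> Braid D (FObj F a) (FObj F b)) \<cdot>\<^bsub>D\<^esub> (p \<otimes>\<^sub>a\<^bsub>D\<^esub> q)"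
    unfolding ten_strg_def using arr assms(3,4) Strg_Braid by (intro D.Cmp_assoc_eq) auto
  also have "\<dots> = ten_strg b a q p \<cdot>\<^bsub>D\<^esub> Braid D x y"
    using arr obj assms D.Braid_natural[OF assms(1,2)]
    by (simp add: ten_strg_def D.Cmp_assoc_arr)
  finally show ?thesis
    using arr obj assms(3,4) by (simp add: intertwines_def D.Hom_iff ten_strg_def)
qed

lemma intertwines_LUnit:
  assumes "p \<in> Hom D x (FObj F a)" "a \<in> Obj C"
  shows "intertwines (LUnit C a) (LUnit D x) (ten_strg (Unit C) a (Strg0 F) p) p"
proof -
  have obj: "x \<in> Obj D"
    using D.Hom_Obj assms by auto
  have arr: "p \<in> Arr D" "Dom D p = x" "Cod D p = FObj F a"
    using assms by (auto simp: D.Hom_iff)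
  \<comment> \<open>Splitting off \<open>p\<close> isolates the left unit law of \<open>F\<close>;
    naturality of the left unitor handles the remaining factor.\<close>
  have "ten_strg (Unit C) a (Strg0 F) p =
      (Strg F (Unit C) a \<cdot>\<^bsub>D\<^esub> (Strg0 F \<otimes>\<^sub>a\<^bsub>D\<^esub> Idn D (FObj F a)))
        \<cdot>\<^bsub>D\<^esub> (Idn D (Unit D) \<otimes>\<^sub>a\<^bsub>D\<^esub> p)"
    using arr obj assms(2) by (simp add: ten_strg_def D.Cmp_assoc_arr D.TenA_Cmp_arr)
  then have "FArr F (LUnit C a) \<cdot>\<^bsub>D\<^esub> ten_strg (Unit C) a (Strg0 F) p =
      LUnit D (FObj F a) \<cdot>\<^bsub>D\<^esub> (Idn D (Unit D) \<otimes>\<^sub>a\<^bsub>D\<^esub> p)"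
    using arr obj assms(2) Strg_LUnit[OF assms(2)]
    by (auto intro!: D.Cmp_assoc_eq simp del: D.Cmp_Idn)
  also have "\<dots> = p \<cdot>\<^bsub>D\<^esub> LUnit D x"
    using D.LUnit_natural[OF assms(1)] .
  finally show ?thesis
    using arr obj assms(2) by (simp add: intertwines_def D.Hom_iff ten_strg_def)
qed

lemma intertwines_Assoc:
  assumes "p \<in> Hom D x (FObj F a)" "q \<in> Hom D y (FObj F b)" "r \<in> Hom D z (FObj F c)"
    and "a \<in> Obj C" "b \<in> Obj C" "c \<in> Obj C"
  shows "intertwines (Assoc C a b c) (Assoc D x y z)
    (ten_strg (a \<otimes>\<^bsub>C\<^esub> b) c (ten_strg a b p q) r) (ten_strg a (b \<otimes>\<^bsub>C\<^esub> c) p (ten_strg b c q r))"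
proof -
  have obj: "x \<in> Obj D" "y \<in> Obj D" "z \<in> Obj D"
    using D.Hom_Obj assms by auto
  have arr: "p \<in> Arr D" "q \<in> Arr D" "r \<in> Arr D" "Dom D p = x" "Dom D q = y" "Dom D r = z"
    "Cod D p = FObj F a" "Cod D q = FObj F b" "Cod D r = FObj F c"
    using assms by (auto simp: D.Hom_iff)
  \<comment> \<open>\<open>?L\<close> and \<open>?R\<close> are the composite strongators in the
    associativity axiom of \<open>F\<close>; \<open>p\<close>, \<open>q\<close> and \<open>r\<close>
    are split off and carried across by naturality of the associator in \<open>D\<close>.\<close>
  let ?L = "Strg F (a \<otimes>\<^bsub>C\<^esub> b) c \<cdot>\<^bsub>D\<^esub> (Strg F a b \<otimes>\<^sub>a\<^bsub>D\<^esub> Idn D (FObj F c))"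
  let ?R = "Strg F a (b \<otimes>\<^bsub>C\<^esub> c) \<cdot>\<^bsub>D\<^esub> (Idn D (FObj F a) \<otimes>\<^sub>a\<^bsub>D\<^esub> Strg F b c)"
  have "ten_strg (a \<otimes>\<^bsub>C\<^esub> b) c (ten_strg a b p q) r = ?L \<cdot>\<^bsub>D\<^esub> ((p \<otimes>\<^sub>a\<^bsub>D\<^esub> q) \<otimes>\<^sub>a\<^bsub>D\<^esub> r)"
    using arr obj assms(4-6) by (simp add: ten_strg_def D.Cmp_assoc_arr D.TenA_Cmp_arr)
  then have "FArr F (Assoc C a b c) \<cdot>\<^bsub>D\<^esub> ten_strg (a \<otimes>\<^bsub>C\<^esub> b) c (ten_strg a b p q) r =
      (FArr F (Assoc C a b c) \<cdot>\<^bsub>D\<^esub> ?L) \<cdot>\<^bsub>D\<^esub> ((p \<otimes>\<^sub>a\<^bsub>D\<^esub> q) \<otimes>\<^sub>a\<^bsub>D\<^esub> r)"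
    using arr obj assms(4-6) by (simp add: D.Cmp_assoc_arr)
  also have "\<dots> = ?R \<cdot>\<^bsub>D\<^esub> Assoc D (FObj F a) (FObj F b) (FObj F c) \<cdot>\<^bsub>D\<^esub> ((p \<otimes>\<^sub>a\<^bsub>D\<^esub> q) \<otimes>\<^sub>a\<^bsub>D\<^esub> r)"
    using arr obj assms(4-6) by (simp add: Strg_Assoc D.Cmp_assoc_arr)
  also have "\<dots> = (?R \<cdot>\<^bsub>D\<^esub> (p \<otimes>\<^sub>a\<^bsub>D\<^esub> (q \<otimes>\<^sub>a\<^bsub>D\<^esub> r))) \<cdot>\<^bsub>D\<^esub> Assoc D x y z"
    using arr obj assms(4-6) D.Assoc_natural[OF assms(1-3)] by (simp add: D.Cmp_assoc_arr)
  also have "?R \<cdot>\<^bsub>D\<^esub> (p \<otimes>\<^sub>a\<^bsub>D\<^esub> (q \<otimes>\<^sub>a\<^bsub>D\<^esub> r)) = ten_strg a (b \<otimes>\<^bsub>C\<^esub> c) p (ten_strg b c q r)"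
    using arr obj assms(4-6) by (simp add: ten_strg_def D.Cmp_assoc_arr D.TenA_Cmp_arr)
  finally show ?thesis
    using arr obj assms(4-6) by (simp add: intertwines_def D.Hom_iff ten_strg_def)
qed

text \<open>Each of the five factors of \<open>interchange\<close> is built from associators, a
  braiding, identities, tensor products and inverses, all of which already give squares; pasting the
  five squares gives the result.\<close>

lemma intertwines_interchange:
  assumes p: "p \<in> Hom D x (FObj F a)" "a \<in> Obj C" and q: "q \<in> Hom D y (FObj F b)" "b \<in> Obj C"
    and r: "r \<in> Hom D z (FObj F c)" "c \<in> Obj C" and s: "s \<in> Hom D w (FObj F d)" "d \<in> Obj C"
  shows "intertwines (interchange C a b c d) (interchange D x y z w)
    (ten_strg (a \<otimes>\<^bsub>C\<^esub> b) (c \<otimes>\<^bsub>C\<^esub> d) (ten_strg a b p q) (ten_strg c d r s))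
    (ten_strg (a \<otimes>\<^bsub>C\<^esub> c) (b \<otimes>\<^bsub>C\<^esub> d) (ten_strg a c p r) (ten_strg b d q s))"
proof -
  note objC = p(2) q(2) r(2) s(2)
  have obj: "x \<in> Obj D" "y \<in> Obj D" "z \<in> Obj D" "w \<in> Obj D"
    using D.Hom_Obj p q r s by auto
  \<comment> \<open>The three middle factors all have the form of an identity on the first object
    tensored with a structure map.\<close>
  have tensor_left: "intertwines (Idn C a \<otimes>\<^sub>a\<^bsub>C\<^esub> f) (Idn D x \<otimes>\<^sub>a\<^bsub>D\<^esub> g)
      (ten_strg a e p u) (ten_strg a e' p v)"
    if "intertwines f g u v" "f \<in> Hom C e e'" for f g u v e e'
    using that p by (intro intertwines_TenA intertwines_Idn) (auto intro: C.Idn_Hom)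
  have 1: "intertwines (Assoc C a b (c \<otimes>\<^bsub>C\<^esub> d)) (Assoc D x y (z \<otimes>\<^bsub>D\<^esub> w))
      (ten_strg (a \<otimes>\<^bsub>C\<^esub> b) (c \<otimes>\<^bsub>C\<^esub> d) (ten_strg a b p q) (ten_strg c d r s))
      (ten_strg a (b \<otimes>\<^bsub>C\<^esub> (c \<otimes>\<^bsub>C\<^esub> d)) p (ten_strg b (c \<otimes>\<^bsub>C\<^esub> d) q (ten_strg c d r s)))"
    by (intro intertwines_Assoc ten_strg_Hom p q r s C.Ten_Obj)
  have 2: "intertwines (Idn C a \<otimes>\<^sub>a\<^bsub>C\<^esub> inv_arr C (Assoc C b c d))
      (Idn D x \<otimes>\<^sub>a\<^bsub>D\<^esub> inv_arr D (Assoc D y z w))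
      (ten_strg a (b \<otimes>\<^bsub>C\<^esub> (c \<otimes>\<^bsub>C\<^esub> d)) p (ten_strg b (c \<otimes>\<^bsub>C\<^esub> d) q (ten_strg c d r s)))
      (ten_strg a ((b \<otimes>\<^bsub>C\<^esub> c) \<otimes>\<^bsub>C\<^esub> d) p (ten_strg (b \<otimes>\<^bsub>C\<^esub> c) d (ten_strg b c q r) s))"
    by (intro tensor_left intertwines_inv intertwines_Assoc C.inv_arr_Hom
        C.Assoc_iso D.Assoc_iso C.Assoc_Hom p q r s obj)
  have 3: "intertwines (Idn C a \<otimes>\<^sub>a\<^bsub>C\<^esub> (Braid C b c \<otimes>\<^sub>a\<^bsub>C\<^esub> Idn C d))
      (Idn D x \<otimes>\<^sub>a\<^bsub>D\<^esub> (Braid D y z \<otimes>\<^sub>a\<^bsub>D\<^esub> Idn D w))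
      (ten_strg a ((b \<otimes>\<^bsub>C\<^esub> c) \<otimes>\<^bsub>C\<^esub> d) p (ten_strg (b \<otimes>\<^bsub>C\<^esub> c) d (ten_strg b c q r) s))
      (ten_strg a ((c \<otimes>\<^bsub>C\<^esub> b) \<otimes>\<^bsub>C\<^esub> d) p (ten_strg (c \<otimes>\<^bsub>C\<^esub> b) d (ten_strg c b r q) s))"
    by (intro tensor_left intertwines_TenA intertwines_Braid intertwines_Idn
        C.TenA_Hom C.Braid_Hom C.Idn_Hom p q r s)
  have 4: "intertwines (Idn C a \<otimes>\<^sub>a\<^bsub>C\<^esub> Assoc C c b d) (Idn D x \<otimes>\<^sub>a\<^bsub>D\<^esub> Assoc D z y w)
      (ten_strg a ((c \<otimes>\<^bsub>C\<^esub> b) \<otimes>\<^bsub>C\<^esub> d) p (ten_strg (c \<otimes>\<^bsub>C\<^esub> b) d (ten_strg c b r q) s))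
      (ten_strg a (c \<otimes>\<^bsub>C\<^esub> (b \<otimes>\<^bsub>C\<^esub> d)) p (ten_strg c (b \<otimes>\<^bsub>C\<^esub> d) r (ten_strg b d q s)))"
    by (intro tensor_left intertwines_Assoc C.Assoc_Hom p q r s)
  have 5: "intertwines (inv_arr C (Assoc C a c (b \<otimes>\<^bsub>C\<^esub> d))) (inv_arr D (Assoc D x z (y \<otimes>\<^bsub>D\<^esub> w)))
      (ten_strg a (c \<otimes>\<^bsub>C\<^esub> (b \<otimes>\<^bsub>C\<^esub> d)) p (ten_strg c (b \<otimes>\<^bsub>C\<^esub> d) r (ten_strg b d q s)))
      (ten_strg (a \<otimes>\<^bsub>C\<^esub> c) (b \<otimes>\<^bsub>C\<^esub> d) (ten_strg a c p r) (ten_strg b d q s))"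
    by (intro intertwines_inv intertwines_Assoc ten_strg_Hom C.Assoc_iso D.Assoc_iso
        p q r s obj C.Ten_Obj D.Ten_Obj)
  show ?thesis
    unfolding interchange_def
    by (rule intertwines_Cmp[OF 5 intertwines_Cmp[OF 4 intertwines_Cmp[OF 3 intertwines_Cmp[OF
              2 1]]]]; use objC in \<open>simp add: C.Assoc_iso\<close>)
qed

section \<open>Iterated strongators as tensor powers in the comma category\<close>

lemma iter_strg_Hom:
  "c \<in> Obj C \<Longrightarrow> iter_strg C D F c n \<in> Hom D (tpow D (FObj F c) n) (FObj F (tpow C c n))"
  by (induction n rule: induct_nat_012) (simp_all add: D.Hom_iff)

lemma iso_iter_strg:
  assumes "c \<in> Obj C"
  shows "iso D (iter_strg C D F c n)"
proof (induction n rule: induct_nat_012)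
  case (ge2 n)
  then show ?case
    using assms iter_strg_Hom[OF assms, of "Suc n"]
    by (auto simp: D.Hom_iff Strg_iso intro!: D.iso_Cmp D.iso_TenA D.iso_Idn)
qed (use assms in \<open>simp_all add: Strg0_iso D.iso_Idn\<close>)

text \<open>Shows that iterated strongators are the left-bracketed powers, formed with
  \<open>ten_strg\<close>, of the identity object at \<open>c\<close>.\<close>

lemma iter_strg_Suc:
  "iter_strg C D F c (Suc (Suc n)) =
    ten_strg (tpow C c (Suc n)) c (iter_strg C D F c (Suc n)) (Idn D (FObj F c))"
  by (simp add: ten_strg_def)

text \<open>Composing with the powers of \<open>f\<close> yields the left-bracketed powers of the
  comma object \<open>f\<close>: functoriality of the tensor product lets the last identity absorb
  the last \<open>f\<close>.\<close>

lemma iter_strg_tpowA_Suc: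
  assumes "c \<in> Obj C" "f \<in> Hom D x (FObj F c)"
  shows "iter_strg C D F c (Suc (Suc n)) \<cdot>\<^bsub>D\<^esub> tpowA D f (Suc (Suc n)) =
    ten_strg (tpow C c (Suc n)) c (iter_strg C D F c (Suc n) \<cdot>\<^bsub>D\<^esub> tpowA D f (Suc n)) f"
  using assms iter_strg_Hom[of c "Suc n"] D.tpowA_Hom[OF assms(2), of "Suc n"]
  by (simp add: D.Hom_iff ten_strg_def D.Cmp_assoc_arr D.TenA_Cmp_arr)

text \<open>The source is the product of the powers of the identity objects at \<open>c\<close> and
  \<open>d\<close>, the target is the power of their product. The square is thus the shuffle of the
  comma category, and the induction follows its recursion.\<close>

lemma intertwines_shuffle:
  assumes "c \<in> Obj C" "d \<in> Obj C"
  shows "intertwines (shuffle C c d n) (shuffle D (FObj F c) (FObj F d) n)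
    (ten_strg (tpow C c n) (tpow C d n) (iter_strg C D F c n) (iter_strg C D F d n))
    (iter_strg C D F (c \<otimes>\<^bsub>C\<^esub> d) n \<cdot>\<^bsub>D\<^esub> tpowA D (Strg F c d) n)"
proof (induction n rule: induct_nat_012)
  case 0
  show ?case
    \<comment> \<open>For the zeroth power the shuffle is the left unitor at the unit, so this is
      the unit law of \<open>F\<close>.\<close>
    using intertwines_LUnit[OF Strg0_Hom] by simp
next
  case 1
  show ?case
    using intertwines_Idn[OF Strg_Hom[OF assms]] assms by (simp add: ten_strg_Idn)
next
  case (ge2 n)
  have "intertwines
      (shuffle C c d (Suc n) \<otimes>\<^sub>a\<^bsub>C\<^esub> Idn C (c \<otimes>\<^bsub>C\<^esub> d))
      (shuffle D (FObj F c) (FObj F d) (Suc n) \<otimes>\<^sub>a\<^bsub>D\<^esub> Idn D (FObj F c \<otimes>\<^bsub>D\<^esub> FObj F d))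
      (ten_strg (tpow C c (Suc n) \<otimes>\<^bsub>C\<^esub> tpow C d (Suc n)) (c \<otimes>\<^bsub>C\<^esub> d)
        (ten_strg (tpow C c (Suc n)) (tpow C d (Suc n))
          (iter_strg C D F c (Suc n)) (iter_strg C D F d (Suc n)))
        (Strg F c d))
      (ten_strg (tpow C (c \<otimes>\<^bsub>C\<^esub> d) (Suc n)) (c \<otimes>\<^bsub>C\<^esub> d)
        (iter_strg C D F (c \<otimes>\<^bsub>C\<^esub> d) (Suc n) \<cdot>\<^bsub>D\<^esub> tpowA D (Strg F c d) (Suc n)) (Strg F c d))"
    by (intro intertwines_TenA ge2 intertwines_Idn Strg_Hom C.shuffle_Hom C.Idn_Hom C.Ten_Obj assms)
  moreover have "intertwines (interchange C (tpow C c (Suc n)) c (tpow C d (Suc n)) d)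
      (interchange D (tpow D (FObj F c) (Suc n)) (FObj F c) (tpow D (FObj F d) (Suc n)) (FObj F d))
      (ten_strg (tpow C c (Suc (Suc n))) (tpow C d (Suc (Suc n)))
        (iter_strg C D F c (Suc (Suc n))) (iter_strg C D F d (Suc (Suc n))))
      (ten_strg (tpow C c (Suc n) \<otimes>\<^bsub>C\<^esub> tpow C d (Suc n)) (c \<otimes>\<^bsub>C\<^esub> d)
        (ten_strg (tpow C c (Suc n)) (tpow C d (Suc n))
          (iter_strg C D F c (Suc n)) (iter_strg C D F d (Suc n)))
        (Strg F c d))"
    \<comment> \<open>Reading the strongator backwards as a tensor of two identities supplies the
      four comma objects that the interchange permutes.\<close>
    unfolding iter_strg_Suc tpow.simps(3) ten_strg_Idn[OF assms, symmetric]
    by (intro intertwines_interchange iter_strg_Hom D.Idn_Hom FObj_Obj C.tpow_Obj assms)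
  ultimately show ?case
    unfolding shuffle.simps(3) iter_strg_tpowA_Suc[OF C.Ten_Obj[OF assms] Strg_Hom[OF assms]]
    using assms C.shuffle_Hom[OF assms, of "Suc n"]
      C.interchange_Hom[of "tpow C c (Suc n)" c "tpow C d (Suc n)" d]
    by (intro intertwines_Cmp) (auto simp: C.Hom_iff)
qed

text \<open>The inverted left unitor creates each new unit factor, so inverting its square drives
  the induction; the two base cases are identity squares.\<close>

lemma intertwines_shuffle_unit:
  "intertwines (shuffle_unit C n) (shuffle_unit D n) (Strg0 F)
    (iter_strg C D F (Unit C) n \<cdot>\<^bsub>D\<^esub> tpowA D (Strg0 F) n)"
proof (induction n rule: induct_nat_012)
  case (ge2 n)
  have "intertwines (shuffle_unit C (Suc n) \<otimes>\<^sub>a\<^bsub>C\<^esub> Idn C (Unit C))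
      (shuffle_unit D (Suc n) \<otimes>\<^sub>a\<^bsub>D\<^esub> Idn D (Unit D))
      (ten_strg (Unit C) (Unit C) (Strg0 F) (Strg0 F))
      (ten_strg (tpow C (Unit C) (Suc n)) (Unit C)
        (iter_strg C D F (Unit C) (Suc n) \<cdot>\<^bsub>D\<^esub> tpowA D (Strg0 F) (Suc n)) (Strg0 F))"
    by (intro intertwines_TenA ge2 intertwines_Idn Strg0_Hom C.shuffle_unit_Hom C.Idn_Hom C.Unit_Obj)
  moreover have "intertwines (inv_arr C (LUnit C (Unit C))) (inv_arr D (LUnit D (Unit D)))
      (Strg0 F) (ten_strg (Unit C) (Unit C) (Strg0 F) (Strg0 F))"
    by (intro intertwines_inv intertwines_LUnit Strg0_Hom C.LUnit_iso D.LUnit_iso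
        C.Unit_Obj D.Unit_Obj)
  ultimately show ?case
    unfolding shuffle_unit.simps(3) iter_strg_tpowA_Suc[OF C.Unit_Obj Strg0_Hom]
    using C.shuffle_unit_Hom[of "Suc n"]
    by (intro intertwines_Cmp) (auto simp: C.Hom_iff C.LUnit_iso)
qed (use intertwines_Idn[OF Strg0_Hom] in simp_all)

end


section \<open>Strongators are homomorphisms\<close>

context prop_supply
begin

lemma supply_Hom:
  assumes "c \<in> Obj C" "\<mu> \<in> Hom P m n"
  shows "FArr (s c) \<mu> \<in> Hom C (tpow C c m) (tpow C c n)"
  using strong_monoidal_functor.FArr_Hom[OF supply_functor[OF assms(1)] assms(2)] assms(1)
  by (simp add: supply_FObj)

end

locale supply_preserving_functor =
  strong_monoidal_functor C D F + S: prop_supply P C s + T: prop_supply P D t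
  for P :: "(nat, 'p) smcat"
    and C :: "('o, 'a) smcat" and s :: "'o \<Rightarrow> (nat, 'p, 'o, 'a) monfun"
    and D :: "('o2, 'a2) smcat" and t :: "'o2 \<Rightarrow> (nat, 'p, 'o2, 'a2) monfun"
    and F :: "('o, 'a, 'o2, 'a2) monfun" +
  assumes preserves: "preserves_supply P C D s t F"
begin

text \<open>Preservation of the supply, read in the comma category: the two interpretations of
  \<open>\<mu>\<close> form a morphism between powers of the identity object.\<close>

lemma intertwines_supply:
  assumes "c \<in> Obj C" "\<mu> \<in> Hom P m n"
  shows "intertwines (FArr (s c) \<mu>) (FArr (t (FObj F c)) \<mu>) (iter_strg C D F c m) (iter_strg C D F c n)"
  using assms preserves S.supply_Hom[OF assms] T.supply_Hom[OF FObj_Obj[OF assms(1)] assms(2)]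
    iter_strg_Hom[OF assms(1)]
  by (simp add: intertwines_def preserves_supply_def C.Hom_iff D.Hom_iff)

text \<open>
  The common core of the binary and the nullary case: \<open>\<sigma> k\<close> is \<open>shuffle\<close> or \<open>shuffle_unit\<close>,
  and \<open>p k\<close> is \<open>\<phi> \<circ> (\<phi>\<^sub>k \<otimes> \<phi>\<^sub>k)\<close> or \<open>\<phi>\<close>.
\<close>

lemma supply_commutes:
  assumes a: "a \<in> Obj C" and \<phi>: "\<phi> \<in> Hom D x (FObj F a)" and \<mu>: "\<mu> \<in> Hom P m n"
    and \<sigma>\<^sub>C: "\<And>k. \<sigma>\<^sub>C k \<in> Hom C (e k) (tpow C a k)"
    and \<sigma>: "\<And>k. \<sigma> k \<in> Hom D (y k) (tpow D x k)" "iso D (\<sigma> m)"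
    and sq: "\<And>k. intertwines (\<sigma>\<^sub>C k) (\<sigma> k) (p k) (iter_strg C D F a k \<cdot>\<^bsub>D\<^esub> tpowA D \<phi> k)"
    and fg: "intertwines f g (p m) (p n)" "f \<in> Hom C (e m) (e n)"
    and f: "FArr (s a) \<mu> \<cdot>\<^bsub>C\<^esub> \<sigma>\<^sub>C m = \<sigma>\<^sub>C n \<cdot>\<^bsub>C\<^esub> f"
    and g: "FArr (t x) \<mu> \<cdot>\<^bsub>D\<^esub> \<sigma> m = \<sigma> n \<cdot>\<^bsub>D\<^esub> g"
  shows "tpowA D \<phi> n \<cdot>\<^bsub>D\<^esub> FArr (t x) \<mu> = FArr (t (FObj F a)) \<mu> \<cdot>\<^bsub>D\<^esub> tpowA D \<phi> m"
proof -
  let ?i = "iter_strg C D F a" and ?\<phi> = "tpowA D \<phi>"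
  let ?s = "FArr (s a) \<mu>" and ?t = "FArr (t (FObj F a)) \<mu>" and ?t' = "FArr (t x) \<mu>"
  have x: "x \<in> Obj D"
    using D.Hom_Obj \<phi> by auto
  note homs = D.tpowA_Hom[OF \<phi>, of m] D.tpowA_Hom[OF \<phi>, of n]
    iter_strg_Hom[OF a, of m] iter_strg_Hom[OF a, of n] S.supply_Hom[OF a \<mu>] T.supply_Hom[OF x \<mu>]
    T.supply_Hom[OF FObj_Obj[OF a] \<mu>] \<sigma>\<^sub>C[of m] \<sigma>\<^sub>C[of n] \<sigma>(1)[of m] \<sigma>(1)[of n]
  \<comment> \<open>First route: the square for \<open>f\<close> and \<open>g\<close>, followed by
    the shuffle square at \<open>n\<close>. The hypotheses \<open>f\<close> and \<open>g\<close>
    rewrite it as \<open>\<mu>\<close> applied after the shuffle.\<close>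
  have "intertwines (\<sigma>\<^sub>C n \<cdot>\<^bsub>C\<^esub> f) (\<sigma> n \<cdot>\<^bsub>D\<^esub> g) (p m) (?i n \<cdot>\<^bsub>D\<^esub> ?\<phi> n)"
    using \<sigma>\<^sub>C[of n] fg(2) by (intro intertwines_Cmp[OF sq fg(1)]) (simp add: C.Hom_iff)
  then have "FArr F (?s \<cdot>\<^bsub>C\<^esub> \<sigma>\<^sub>C m) \<cdot>\<^bsub>D\<^esub> p m = (?i n \<cdot>\<^bsub>D\<^esub> ?\<phi> n) \<cdot>\<^bsub>D\<^esub> ?t' \<cdot>\<^bsub>D\<^esub> \<sigma> m"
    unfolding f g intertwines_def by blast
  moreover have "intertwines (?s \<cdot>\<^bsub>C\<^esub> \<sigma>\<^sub>C m) (?t \<cdot>\<^bsub>D\<^esub> ?\<phi> m \<cdot>\<^bsub>D\<^esub> \<sigma> m) (p m) (?i n)"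
  proof -
    \<comment> \<open>Second route: this square over an identity moves the power of
      \<open>\<phi>\<close> out of the comma object into the arrow of \<open>D\<close>, so that the
      supply square for \<open>a\<close> can follow.\<close>
    have "intertwines (Idn C (tpow C a m)) (?\<phi> m) (?i m \<cdot>\<^bsub>D\<^esub> ?\<phi> m) (?i m)"
      using homs(1,3) a by (simp add: intertwines_def D.Hom_iff FArr_Idn)
    from intertwines_Cmp[OF intertwines_supply[OF a \<mu>] intertwines_Cmp[OF this sq]]
    show ?thesis
      using homs a by (simp add: C.Hom_iff)
  qed
  \<comment> \<open>Both routes have the same arrow in \<open>C\<close> and the same source
    \<open>p m\<close>, so their other sides agree.\<close>
  ultimately have "(?i n \<cdot>\<^bsub>D\<^esub> ?\<phi> n) \<cdot>\<^bsub>D\<^esub> ?t' \<cdot>\<^bsub>D\<^esub> \<sigma> m = ?i n \<cdot>\<^bsub>D\<^esub> ?t \<cdot>\<^bsub>D\<^esub> ?\<phi> m \<cdot>\<^bsub>D\<^esub> \<sigma> m"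
    unfolding intertwines_def by simp
  then have "?i n \<cdot>\<^bsub>D\<^esub> (?\<phi> n \<cdot>\<^bsub>D\<^esub> ?t') \<cdot>\<^bsub>D\<^esub> \<sigma> m = ?i n \<cdot>\<^bsub>D\<^esub> (?t \<cdot>\<^bsub>D\<^esub> ?\<phi> m) \<cdot>\<^bsub>D\<^esub> \<sigma> m"
    using homs by (simp add: D.Hom_iff D.Cmp_assoc_arr)
  then have "(?\<phi> n \<cdot>\<^bsub>D\<^esub> ?t') \<cdot>\<^bsub>D\<^esub> \<sigma> m = (?t \<cdot>\<^bsub>D\<^esub> ?\<phi> m) \<cdot>\<^bsub>D\<^esub> \<sigma> m"
    by (rule D.iso_cancel_left[OF iso_iter_strg[OF a]]) (use homs in \<open>simp_all add: D.Hom_iff\<close>)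
  then show ?thesis
    by (rule D.iso_cancel_right[OF \<sigma>(2)]) (use homs in \<open>simp_all add: D.Hom_iff\<close>)
qed

text \<open>Here \<open>f\<close> and \<open>g\<close> are tensor products of interpretations of
  \<open>\<mu>\<close>, and the two shuffle equations are the tensor axioms of the supplies.\<close>

lemma Strg_supply:
  assumes "c \<in> Obj C" "d \<in> Obj C" "\<mu> \<in> Hom P m n"
  shows "tpowA D (Strg F c d) n \<cdot>\<^bsub>D\<^esub> FArr (t (FObj F c \<otimes>\<^bsub>D\<^esub> FObj F d)) \<mu> =
    FArr (t (FObj F (c \<otimes>\<^bsub>C\<^esub> d))) \<mu> \<cdot>\<^bsub>D\<^esub> tpowA D (Strg F c d) m"
  using assms
  by (intro supply_commutes[OF _ Strg_Hom _ C.shuffle_Hom D.shuffle_Hom D.iso_shuffle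
        intertwines_shuffle intertwines_TenA C.TenA_Hom S.supply_Ten T.supply_Ten]
      intertwines_supply S.supply_Hom) auto

text \<open>Here \<open>f\<close> and \<open>g\<close> are identities of the units and
  \<open>p k\<close> is constantly \<open>Strg0 F\<close>; the unit axioms of the supplies give the
  shuffle equations.\<close>

lemma Strg0_supply:
  assumes "\<mu> \<in> Hom P m n"
  shows "tpowA D (Strg0 F) n \<cdot>\<^bsub>D\<^esub> FArr (t (Unit D)) \<mu> =
    FArr (t (FObj F (Unit C))) \<mu> \<cdot>\<^bsub>D\<^esub> tpowA D (Strg0 F) m"
  using assms C.shuffle_unit_Hom[of n] D.shuffle_unit_Hom[of n]
  by (intro supply_commutes[OF C.Unit_Obj Strg0_Hom _ C.shuffle_unit_Hom D.shuffle_unit_Hom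
        D.iso_shuffle_unit intertwines_shuffle_unit intertwines_Idn[OF Strg0_Hom C.Unit_Obj]
        C.Idn_Hom[OF C.Unit_Obj]])
    (simp_all add: S.supply_Unit T.supply_Unit C.Hom_iff D.Hom_iff)

lemma supply_hom_Strg: "c \<in> Obj C \<Longrightarrow> d \<in> Obj C \<Longrightarrow> supply_hom P D t (Strg F c d)"
  by (simp add: supply_hom_def Strg_supply)

lemma supply_hom_Strg0: "supply_hom P D t (Strg0 F)"
  by (simp add: supply_hom_def Strg0_supply)

end

theorem theorem4p7:
  fixes P :: "(nat, 'p) smcat"
    and C :: "('o, 'a) smcat"
    and D :: "('o2, 'a2) smcat"
    and s :: "'o \<Rightarrow> (nat, 'p, 'o, 'a) monfun"
    and t :: "'o2 \<Rightarrow> (nat, 'p, 'o2, 'a2) monfun"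
    and F :: "('o, 'a, 'o2, 'a2) monfun"
  assumes "prop_category P"
    and "symmetric_monoidal_category C"
    and "symmetric_monoidal_category D"
    and "prop_supply P C s"
    and "prop_supply P D t"
    and "strong_monoidal_functor C D F"
    and "preserves_supply P C D s t F"
  shows "(\<forall>c\<in>Obj C. \<forall>c'\<in>Obj C. supply_hom P D t (Strg F c c'))
    \<and> supply_hom P D t (Strg0 F)
    \<and> (\<forall>m n. \<forall>\<mu>\<in>Hom P m n. \<forall>c\<in>Obj C. \<forall>c'\<in>Obj C.
          tpowA D (Strg F c c') n \<cdot>\<^bsub>D\<^esub> FArr (t (FObj F c \<otimes>\<^bsub>D\<^esub> FObj F c')) \<mu>
            \<in> Hom D (tpow D (FObj F c \<otimes>\<^bsub>D\<^esub> FObj F c') m) (tpow D (FObj F (c \<otimes>\<^bsub>C\<^esub> c')) n)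
        \<and> tpowA D (Strg F c c') n \<cdot>\<^bsub>D\<^esub> FArr (t (FObj F c \<otimes>\<^bsub>D\<^esub> FObj F c')) \<mu> =
          FArr (t (FObj F (c \<otimes>\<^bsub>C\<^esub> c'))) \<mu> \<cdot>\<^bsub>D\<^esub> tpowA D (Strg F c c') m)
    \<and> (\<forall>m n. \<forall>\<mu>\<in>Hom P m n.
          tpowA D (Strg0 F) n \<cdot>\<^bsub>D\<^esub> FArr (t (Unit D)) \<mu>
            \<in> Hom D (tpow D (Unit D) m) (tpow D (FObj F (Unit C)) n)
        \<and> tpowA D (Strg0 F) n \<cdot>\<^bsub>D\<^esub> FArr (t (Unit D)) \<mu> =
          FArr (t (FObj F (Unit C))) \<mu> \<cdot>\<^bsub>D\<^esub> tpowA D (Strg0 F) m)"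
proof -
  interpret supply_preserving_functor P C s D t F
    using assms by (simp add: supply_preserving_functor_def supply_preserving_functor_axioms_def)
  \<comment> \<open>Supplies the membership in hom-sets by which the theorem states source and
    target of its equations.\<close>
  have "tpowA D \<phi> n \<cdot>\<^bsub>D\<^esub> FArr (t x) \<mu> \<in> Hom D (tpow D x m) (tpow D y n)"
    if "\<phi> \<in> Hom D x y" "\<mu> \<in> Hom P m n" for \<phi> x y \<mu> m n
    using that D.Hom_Obj[OF that(1)] by (intro D.Cmp_Hom[OF T.supply_Hom D.tpowA_Hom]) auto
  then show ?thesis
    by (intro conjI ballI allI supply_hom_Strg supply_hom_Strg0 Strg_supply Strg0_supply)
      (use Strg_Hom Strg0_Hom in blast)+
qed

end
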